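(* Let $\mathfrak{H}$ be a Hilbert space of dimension $q$ with error basis $\mathcal{E}$, and let $\mathfrak{C}$ be an $[[n,k,d]]_q$ stabilizer code in $\mathfrak{H}^{\otimes n}$ with stabilizer group $\mathcal{S}(\mathfrak{C})$ and normalizer $\mathcal{N}(\mathfrak{C})$. Let $\mathbf{wt}_1$ and $\mathbf{wt}_2$ be scalar weight functions on $\mathcal{E}^n$ that have MacWilliams transforms $\Phi_1$ and $\Phi_2$ respectively, with associated tuples of indeterminates $\mathbf{u}_1$ and $\mathbf{u}_2$. Then $$\sum_{D\in\mathcal{N}(\mathfrak{C})}\Phi_1(\mathbf{u}_1)^{\mathbf{wt}_1(D)}\,\Phi_2(\mathbf{u}_2)^{\mathbf{wt}_2(D)} = \frac{1}{q^{n-k}} \sum_{\substack{E_1,E_2\in\mathcal{E}^n\\ E_1E_2\in\mathcal{S}(\mathfrak{C})}} \mathbf{u}_1^{\mathbf{wt}_1(E_1)}\,\mathbf{u}_2^{\mathbf{wt}_2(E_2)}$$ and $$\sum_{D\in\mathcal{S}(\mathfrak{C})}\Phi_1(\mathbf{u}_1)^{\mathbf{wt}_1(D)}\,\Phi_2(\mathbf{u}_2)^{\mathbf{wt}_2(D)} = \frac{1}{q^{n+k}} \sum_{\substack{E_1,E_2\in\mathcal{E}^n\\ E_1E_2\in\mathcal{N}(\mathfrak{C})}} \mathbf{u}_1^{\mathbf{wt}_1(E_1)}\,\mathbf{u}_2^{\mathbf{wt}_2(E_2)}.$$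
   Context: Error basis: an error basis on a Hilbert space $\mathfrak{H}$ of dimension $q$ is a basis $\mathcal{E}$ of $L(\mathfrak{H})$ consisting of unitary operators, such that $I\in\mathcal{E}$; $\mathrm{Tr}(E^\dagger F)=0$ for distinct $E,F\in\mathcal{E}$; and $EF=\omega(E,F)FE$ for all $E,F\in\mathcal{E}$, where $\omega(E,F)\in\mathbb{C}$ satisfies $\omega(E,F)^r=1$ for some fixed $r$. (Example: the Pauli basis $\{X_q^aZ_q^b\}$ of $\mathbb{C}^q$.) On $\mathfrak{H}^{\otimes n}$ one uses the error basis $\mathcal{E}^n=\{E_1\otimes\cdots\otimes E_n : E_i\in\mathcal{E}\}$, with $\omega$ defined by the same commutation relation; $\omega$ extends in the same way to scalar (phase) multiples and products of elements of $\mathcal{E}^n$. A product of elements of $\mathcal{E}^n$ is a phase times a unique element of $\mathcal{E}^n$. Stabilizer code: an $[[n,k,d]]_q$ stabilizer code $\mathfrak{C}\subseteq\mathfrak{H}^{\otimes n}$ is the joint $+1$ eigenspace of an abelian group of order $q^{n-k}$ whose elements are phase multiples of elements of $\mathcal{E}^n$ and whose only scalar element is $I$; $\dim\mathfrak{C}=q^k$, and $d$ is the code distance. $\mathcal{S}(\mathfrak{C})$ denotes this stabilizer group, its elements being identified with the proportional elements of $\mathcal{E}^n$. The normalizer is $\mathcal{N}(\mathfrak{C})=\{P\in\mathcal{E}^n : \omega(P,S)=1 \text{ for all } S\in\mathcal{S}(\mathfrak{C})\}$. Membership such as $E_1E_2\in\mathcal{S}(\mathfrak{C})$ or $E_1E_2\in\mathcal{N}(\mathfrak{C})$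 is understood up to a phase. Weight functions: a (scalar) weight function on $\mathcal{E}$ is any function $\mathrm{wt}:\mathcal{E}\to\mathbb{Z}_{\ge0}^{\ell}$. For a tuple of indeterminates $\mathbf{u}=(u_1,\dots,u_\ell)$ and $a\in\mathbb{Z}^\ell_{\ge0}$ write $\mathbf{u}^{a}=u_1^{a_1}\cdots u_\ell^{a_\ell}$. An algebraic (polynomial) mapping $\Phi(\mathbf{u})=(\Phi_1(\mathbf{u}),\dots,\Phi_\ell(\mathbf{u}))$ is a MacWilliams transform for $\mathrm{wt}$ if for all $D\in\mathcal{E}$, $$\Phi(\mathbf{u})^{\mathrm{wt}(D)}=\frac1q\sum_{E\in\mathcal{E}}\omega(D,E)\,\mathbf{u}^{\mathrm{wt}(E)}.$$ A weight function $\mathbf{wt}$ on $\mathcal{E}^n$ is given by a tuple $(\mathrm{wt}^{(1)},\dots,\mathrm{wt}^{(n)})$ of weight functions $\mathcal{E}\to\mathbb{Z}^\ell_{\ge0}$ through $\mathbf{wt}(E_1\otimes\cdots\otimes E_n)=\sum_{i=1}^n\mathrm{wt}^{(i)}(E_i)$; $\Phi$ is a MacWilliams transform for $\mathbf{wt}$ if it is one for each $\mathrm{wt}^{(i)}$. (The number $\ell$ of indeterminates may differ between $\mathbf{wt}_1$ and $\mathbf{wt}_2$.) *)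

theory Defs
  imports "HOL-Analysis.Analysis" "HOL-Algebra.Group" "HOL-Library.Poly_Mapping"
begin

section \<open>Complex matrices and tensor products\<close>

text \<open>
  The Hilbert space of dimension \<open>q = CARD('q)\<close> is \<open>\<complex>\<^sup>q\<close>, i.e. the type \<open>complex ^ 'q\<close>.
  Its \<open>n\<close>-fold tensor power, \<open>n = CARD('n)\<close>, is \<open>complex ^ ('q ^ 'n)\<close>: the basis vector
  with index \<open>r\<close> is the tensor product of the basis vectors with indices \<open>r $ i\<close>.
  Products of matrices are always \<open>**\<close>; the overloaded \<open>*\<close> on vectors is componentwise.
\<close>

type_synonym 'm cmat = "complex ^ 'm ^ 'm"

definition cmat_scale :: "complex \<Rightarrow> 'm::finite cmat \<Rightarrow> 'm cmat"  (infixr \<open>*\<^sub>C\<close> 75)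
  where "c *\<^sub>C A = (\<chi> i j. c * A $ i $ j)"

interpretation cmat: vector_space "cmat_scale :: complex \<Rightarrow> 'm::finite cmat \<Rightarrow> 'm cmat"
  by unfold_locales (simp_all add: cmat_scale_def vec_eq_iff algebra_simps)

definition adjoint_mat :: "'m::finite cmat \<Rightarrow> 'm cmat"
  where "adjoint_mat A = (\<chi> i j. cnj (A $ j $ i))"

definition unitary_mat :: "'m::finite cmat \<Rightarrow> bool"
  where "unitary_mat U \<longleftrightarrow> adjoint_mat U ** U = mat 1 \<and> U ** adjoint_mat U = mat 1"

definition tensor :: "('n::finite \<Rightarrow> 'q::finite cmat) \<Rightarrow> ('q ^ 'n) cmat"
  where "tensor F = (\<chi> r c. \<Prod>i\<in>UNIV. F i $ (r $ i) $ (c $ i))"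


section \<open>Error bases\<close>

text \<open>
  \<open>\<omega>(A, B)\<close> is meaningful if \<open>A\<close> and \<open>B\<close> commute up to a scalar and \<open>B ** A \<noteq> 0\<close>; the
  scalar is then unique.  The same constant serves the one-site and the \<open>n\<close>-site operators.
\<close>

definition omega :: "'m::finite cmat \<Rightarrow> 'm cmat \<Rightarrow> complex"
  where "omega A B = (THE w. A ** B = w *\<^sub>C (B ** A))"

definition error_basis :: "'q::finite cmat set \<Rightarrow> bool"
  where "error_basis \<E> \<longleftrightarrow>
    cmat.independent \<E> \<and> cmat.span \<E> = UNIV \<and>
    (\<forall>E\<in>\<E>. unitary_mat E) \<and>
    mat 1 \<in> \<E> \<and>
    (\<forall>E\<in>\<E>. \<forall>F\<in>\<E>. E \<noteq> F \<longrightarrow> trace (adjoint_mat E ** F) = 0) \<and>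
    (\<exists>r>0. \<forall>E\<in>\<E>. \<forall>F\<in>\<E>. \<exists>w. E ** F = w *\<^sub>C (F ** E) \<and> w ^ r = 1)"

definition tensor_basis :: "'q::finite cmat set \<Rightarrow> ('q ^ 'n::finite) cmat set"
  where "tensor_basis \<E> = {tensor F | F. \<forall>i. F i \<in> \<E>}"


section \<open>Stabilizer codes\<close>

definition mem_up_to_phase :: "'m::finite cmat \<Rightarrow> 'm cmat set \<Rightarrow> bool"
  where "mem_up_to_phase A S \<longleftrightarrow> (\<exists>c. cmod c = 1 \<and> c *\<^sub>C A \<in> S)"

definition mat_monoid :: "'m::finite cmat set \<Rightarrow> 'm cmat monoid"
  where "mat_monoid G = \<lparr>carrier = G, monoid.mult = (**), one = mat 1\<rparr>"

definition stabilizer_group ::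
    "'q::finite cmat set \<Rightarrow> nat \<Rightarrow> ('q ^ 'n::finite) cmat set \<Rightarrow> bool"
  where "stabilizer_group \<E> k G \<longleftrightarrow>
    comm_group (mat_monoid G) \<and>
    k \<le> CARD('n) \<and> finite G \<and> card G = CARD('q) ^ (CARD('n) - k) \<and>
    (\<forall>g\<in>G. \<exists>c E. cmod c = 1 \<and> E \<in> tensor_basis \<E> \<and> g = c *\<^sub>C E) \<and>
    (\<forall>c. c *\<^sub>C mat 1 \<in> G \<longrightarrow> c = 1)"

definition joint_fixed_space :: "'m::finite cmat set \<Rightarrow> (complex ^ 'm) set"
  where "joint_fixed_space G = {v. \<forall>g\<in>G. g *v v = v}"

definition stabilizer ::
    "'q::finite cmat set \<Rightarrow> ('q ^ 'n::finite) cmat set \<Rightarrow> ('q ^ 'n) cmat set"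
  where "stabilizer \<E> G = {E \<in> tensor_basis \<E>. mem_up_to_phase E G}"

definition normalizer ::
    "'q::finite cmat set \<Rightarrow> ('q ^ 'n::finite) cmat set \<Rightarrow> ('q ^ 'n) cmat set"
  where "normalizer \<E> G = {P \<in> tensor_basis \<E>. \<forall>S\<in>stabilizer \<E> G. omega P S = 1}"

text \<open>
  The distance is the least Hamming weight of an element of the normalizer outside the
  stabilizer.  For \<open>k = 0\<close> the two coincide, and the usual convention takes the
  least weight of a non-identity element of the stabilizer.
\<close>

definition code_distance ::
    "'q::finite cmat set \<Rightarrow> nat \<Rightarrow> ('q ^ 'n::finite) cmat set \<Rightarrow> nat"
  where "code_distance \<E> k G =
    Inf {card {i. F i \<noteq> mat 1} | F. (\<forall>i. F i \<in> \<E>) \<and>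
      tensor F \<in> (if k = 0 then stabilizer \<E> G - {mat 1}
                  else normalizer \<E> G - stabilizer \<E> G)}"

text \<open>
  \<open>C\<close> is an \<open>[[n, k, d]]\<^sub>q\<close> stabilizer code with stabilizer group \<open>G\<close>, where \<open>n = CARD('n)\<close>
  and \<open>q = CARD('q)\<close>.  That \<open>C\<close> has dimension \<open>q\<^sup>k\<close> is a consequence.
\<close>

definition stabilizer_code ::
    "'q::finite cmat set \<Rightarrow> nat \<Rightarrow> nat \<Rightarrow> ('q ^ 'n::finite) cmat set \<Rightarrow> (complex ^ ('q ^ 'n)) set \<Rightarrow> bool"
  where "stabilizer_code \<E> k d G C \<longleftrightarrow>
    stabilizer_group \<E> k G \<and> C = joint_fixed_space G \<and> d = code_distance \<E> k G"


section \<open>Polynomials in several indeterminates\<close>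

text \<open>
  Formal polynomials over \<open>\<complex>\<close> with indeterminates indexed by \<open>'x\<close>: finitely supported maps
  from monomials (finitely supported exponent functions) to coefficients.
\<close>

type_synonym 'x mpoly = "('x \<Rightarrow>\<^sub>0 nat) \<Rightarrow>\<^sub>0 complex"

definition Const :: "complex \<Rightarrow> 'x mpoly"
  where "Const c = Poly_Mapping.single 0 c"

definition Var :: "'x \<Rightarrow> 'x mpoly"
  where "Var x = Poly_Mapping.single (Poly_Mapping.single x 1) 1"

definition tuple_power :: "'r::comm_monoid_mult ^ 'l::finite \<Rightarrow> nat ^ 'l \<Rightarrow> 'r"
  where "tuple_power u a = (\<Prod>j\<in>UNIV. (u $ j) ^ (a $ j))"

text \<open>Substitution of a tuple of polynomials \<open>u\<close>, possibly in other indeterminates, in \<open>p\<close>:\<close>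

definition subst_poly :: "'l::finite mpoly \<Rightarrow> 'x mpoly ^ 'l \<Rightarrow> 'x mpoly"
  where "subst_poly p u =
    (\<Sum>m\<in>Poly_Mapping.keys p.
      Const (Poly_Mapping.lookup p m) * tuple_power u (\<chi> j. Poly_Mapping.lookup m j))"

text \<open>
  A polynomial mapping \<open>\<Phi> = (\<Phi>\<^sub>1, \<dots>, \<Phi>\<^sub>\<ell>)\<close> in \<open>\<ell> = CARD('l)\<close> indeterminates is a
  tuple of polynomials, and \<open>\<Phi>(u)\<close> is the tuple of the \<open>\<Phi>\<^sub>j(u)\<close>.
\<close>

definition apply_map :: "'l::finite mpoly ^ 'l \<Rightarrow> 'x mpoly ^ 'l \<Rightarrow> 'x mpoly ^ 'l"
  where "apply_map \<Phi> u = (\<chi> j. subst_poly (\<Phi> $ j) u)"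


lemma apply_map_Var:
  fixes \<Phi> :: "'l::finite mpoly ^ 'l"
  shows "apply_map \<Phi> (\<chi> j. Var j) = \<Phi>"
proof -
  have pw: "(Var j :: 'l mpoly) ^ a = Poly_Mapping.single (Poly_Mapping.single j a) 1" for j a
    by (induction a) (simp_all add: Var_def mult_single single_add [symmetric] add.commute)
  have mon: "(\<Prod>j\<in>J. Poly_Mapping.single (f j) (1::complex)) = Poly_Mapping.single (\<Sum>j\<in>J. f j) 1"
    if "finite J" for J :: "'l set" and f :: "'l \<Rightarrow> 'l \<Rightarrow>\<^sub>0 nat"
    using that by (induction J rule: finite_induct) (simp_all add: mult_single)
  have split: "(\<Sum>j\<in>UNIV. Poly_Mapping.single j (Poly_Mapping.lookup m j)) = m" for m :: "'l \<Rightarrow>\<^sub>0 nat"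
    by (rule poly_mapping_eqI) (simp add: lookup_sum lookup_single when_def)
  have "subst_poly p (\<chi> j. Var j) = p" for p :: "'l mpoly"
  proof -
    have "subst_poly p (\<chi> j. Var j) =
        (\<Sum>m\<in>Poly_Mapping.keys p. Poly_Mapping.single m (Poly_Mapping.lookup p m))"
      by (simp add: subst_poly_def tuple_power_def pw mon split Const_def mult_single)
    also have "\<dots> = p"
      by (rule poly_mapping_eqI)
        (auto simp: lookup_sum lookup_single when_def in_keys_iff)
    finally show ?thesis .
  qed
  then show ?thesis by (simp add: apply_map_def vec_eq_iff)
qed


section \<open>Weight functions and MacWilliams transforms\<close>

definition macwilliams_transform ::
    "'q::finite cmat set \<Rightarrow> ('q cmat \<Rightarrow> nat ^ 'l::finite) \<Rightarrow> 'l mpoly ^ 'l \<Rightarrow> bool"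
  where "macwilliams_transform \<E> w \<Phi> \<longleftrightarrow>
    (let u = (\<chi> j. Var j) in
     \<forall>D\<in>\<E>. tuple_power (apply_map \<Phi> u) (w D) =
       Const (1 / of_nat CARD('q)) * (\<Sum>E\<in>\<E>. Const (omega D E) * tuple_power u (w E)))"

text \<open>
  \<open>wt\<close> is the weight function on the tensor basis given by the tuple \<open>w\<close>.  Its values
  outside the tensor basis are irrelevant, and it exists and is unique on the tensor basis,
  since a tensor product of elements of an error basis determines its factors.
\<close>

definition weight_given_by ::
    "'q::finite cmat set \<Rightarrow> ('n::finite \<Rightarrow> 'q cmat \<Rightarrow> nat ^ 'l::finite) \<Rightarrow>
      (('q ^ 'n) cmat \<Rightarrow> nat ^ 'l) \<Rightarrow> bool"
  where "weight_given_by \<E> w wt \<longleftrightarrow>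
    (\<forall>F. (\<forall>i. F i \<in> \<E>) \<longrightarrow> wt (tensor F) = (\<Sum>i\<in>UNIV. w i (F i)))"

definition macwilliams_transform_tensor ::
    "'q::finite cmat set \<Rightarrow> ('n::finite \<Rightarrow> 'q cmat \<Rightarrow> nat ^ 'l::finite) \<Rightarrow> 'l mpoly ^ 'l \<Rightarrow> bool"
  where "macwilliams_transform_tensor \<E> w \<Phi> \<longleftrightarrow> (\<forall>i. macwilliams_transform \<E> (w i) \<Phi>)"

end

(*
  The n-fold tensors of an error basis form an error basis again, so it suffices to argue with
  one error basis E of N x N matrices, with N = q^n.  Up to phases E is an abelian group on which
  omega is a nondegenerate bicharacter: an element commuting with all of E commutes with all
  matrices, hence is the identity.  The stabilizer S is a subgroup and the normalizer is its
  orthogonal complement under omega.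

  Multiplying out the one-site MacWilliams identities over the n sites gives
  Phi(u)^wt(D) = q^(-n) * sum over E of omega(D,E) u^wt(E).  The product of two such expansions
  involves omega(D,E1) omega(D,E2) = omega(D,E1 E2), and summing over D in a subgroup leaves, by
  orthogonality of characters, only the pairs with E1 E2 in the orthogonal complement.
*)

theory Submission
  imports Defs
begin

subsection \<open>Matrix algebra\<close>

lemma cmat_scale_nth [simp]: "(c *\<^sub>C A) $ i $ j = c * A $ i $ j"
  by (simp add: cmat_scale_def)

lemma cmat_scale_mult_left [simp]: "(c *\<^sub>C A) ** B = c *\<^sub>C (A ** B)"
  by (simp add: vec_eq_iff matrix_matrix_mult_def sum_distrib_left mult.assoc)

lemma cmat_scale_mult_right [simp]: "A ** (c *\<^sub>C B) = c *\<^sub>C (A ** B)"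
  by (simp add: vec_eq_iff matrix_matrix_mult_def sum_distrib_left mult_ac)

lemma cmat_mult_add_left: "(A + B) ** C = A ** C + B ** C" for A :: "'m::finite cmat"
  by (simp add: vec_eq_iff matrix_matrix_mult_def sum.distrib algebra_simps)

lemma cmat_mult_sum_right: "A ** (\<Sum>x\<in>X. f x) = (\<Sum>x\<in>X. A ** f x)" for A :: "'m::finite cmat"
  by (induction X rule: infinite_finite_induct) (simp_all add: matrix_add_ldistrib)

lemma cmat_mult_sum_left: "(\<Sum>x\<in>X. f x) ** A = (\<Sum>x\<in>X. f x ** A)" for f :: "'a \<Rightarrow> 'm::finite cmat"
  by (induction X rule: infinite_finite_induct) (simp_all add: cmat_mult_add_left)

lemma trace_cmat_scale [simp]: "trace (c *\<^sub>C A) = c * trace A"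
  by (simp add: trace_def sum_distrib_left)

lemma trace_sum: "trace (\<Sum>x\<in>X. f x) = (\<Sum>x\<in>X. trace (f x))" for f :: "'a \<Rightarrow> 'm::finite cmat"
  by (induction X rule: infinite_finite_induct) (simp_all add: trace_add trace_0[unfolded mat_0])

lemma adjoint_mat_mult: "adjoint_mat (A ** B) = adjoint_mat B ** adjoint_mat A"
  by (simp add: adjoint_mat_def vec_eq_iff matrix_matrix_mult_def cnj_sum mult.commute)

lemma adjoint_mat_scale: "adjoint_mat (c *\<^sub>C A) = cnj c *\<^sub>C adjoint_mat A"
  by (simp add: adjoint_mat_def vec_eq_iff)

lemma mat_1_neq_0 [simp]: "(mat 1 :: 'm::finite cmat) \<noteq> 0"
  by (simp add: mat_def vec_eq_iff)

lemma unitary_mat_mult: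
  assumes "unitary_mat A" "unitary_mat B"
  shows "unitary_mat (A ** B)"
proof -
  have "adjoint_mat (A ** B) ** (A ** B) = adjoint_mat B ** (adjoint_mat A ** A) ** B"
    "(A ** B) ** adjoint_mat (A ** B) = A ** (B ** adjoint_mat B) ** adjoint_mat A"
    by (simp_all add: adjoint_mat_mult matrix_mul_assoc)
  then show ?thesis using assms by (simp add: unitary_mat_def)
qed

lemma unitary_mat_cancel_left:
  assumes "unitary_mat A" "A ** B = A ** C"
  shows "B = C"
  using arg_cong[OF assms(2), of "(**) (adjoint_mat A)"] assms(1)
  by (simp add: matrix_mul_assoc unitary_mat_def)

lemma unitary_mat_neq_0: "unitary_mat A \<Longrightarrow> A \<noteq> 0"
  by (auto simp: unitary_mat_def)

text \<open>Scaling \<open>B\<close> by \<open>c\<close> multiplies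
  \<open>adjoint_mat B ** B\<close> by the squared modulus of \<open>c\<close>, and both products
  are \<open>mat 1\<close>. Proportional unitaries thus differ by a phase only.\<close>

lemma unitary_mat_scale_norm:
  assumes "unitary_mat A" "unitary_mat B" "A = c *\<^sub>C B"
  shows "cmod c = 1"
proof -
  have "adjoint_mat A ** A = (cnj c * c) *\<^sub>C mat 1"
    using assms(2,3) by (simp add: adjoint_mat_scale unitary_mat_def mult.commute)
  then have "(cnj c * c) *\<^sub>C mat 1 = (1 :: complex) *\<^sub>C (mat 1 :: 'a cmat)"
    using assms(1) by (simp add: unitary_mat_def)
  then have "cnj c * c = 1"
    by (subst (asm) cmat.scale_cancel_right) auto
  then have "complex_of_real ((cmod c)\<^sup>2) = 1"
    by (metis complex_norm_square mult.commute)
  then have "(cmod c)\<^sup>2 = 1"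
    by (metis of_real_eq_1_iff)
  then show ?thesis
    by (metis norm_ge_zero power2_eq_1_iff le_minus_one_simps(3))
qed

section \<open>Matrix units, the dimension of the matrix space, and its centre\<close>

definition unit_cmat :: "'m::finite \<Rightarrow> 'm \<Rightarrow> 'm cmat"
  where "unit_cmat i j = (\<chi> a b. if a = i \<and> b = j then 1 else 0)"

lemma sum_unit_cmat_nth:
  "(\<Sum>(i, j)\<in>UNIV. c i j *\<^sub>C unit_cmat i j) $ a $ b = c a b"
proof -
  have "(\<Sum>(i, j)\<in>UNIV. c i j *\<^sub>C unit_cmat i j) $ a $ b =
      (\<Sum>p\<in>UNIV. if p = (a, b) then c a b else 0)"
    unfolding sum_component by (intro sum.cong) (auto simp: unit_cmat_def split: if_splits)
  then show ?thesis by simp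
qed

lemma inj_unit_cmat: "inj (\<lambda>(i, j). unit_cmat i j)"
proof (rule injI)
  fix p p' :: "'a \<times> 'a"
  assume "(case p of (i, j) \<Rightarrow> unit_cmat i j) = (case p' of (i, j) \<Rightarrow> unit_cmat i j)"
  then have "(case p of (i, j) \<Rightarrow> unit_cmat i j) $ fst p $ snd p =
      (case p' of (i, j) \<Rightarrow> unit_cmat i j) $ fst p $ snd p" by simp
  then show "p = p'"
    by (auto simp: unit_cmat_def case_prod_beta split: if_splits intro: prod_eqI)
qed

lemma independent_unit_cmat:
  "cmat.independent (range (\<lambda>(i, j). unit_cmat i j :: 'a::finite cmat))"
proof (rule cmat.independent_if_scalars_zero)
  fix f :: "'a cmat \<Rightarrow> complex" and x :: "'a cmat"
  assume sum0: "(\<Sum>x\<in>range (\<lambda>(i, j). unit_cmat i j). f x *\<^sub>C x) = 0"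
    and "x \<in> range (\<lambda>(i, j). unit_cmat i j)"
  then obtain i j where x: "x = unit_cmat i j" by auto
  have "(\<Sum>x\<in>range (\<lambda>(i, j). unit_cmat i j). f x *\<^sub>C x) =
      (\<Sum>(i, j)\<in>UNIV. f (unit_cmat i j) *\<^sub>C unit_cmat i j)"
    by (subst sum.reindex[OF inj_unit_cmat]) (simp add: case_prod_beta)
  then have "(\<Sum>(i, j)\<in>UNIV. f (unit_cmat i j) *\<^sub>C (unit_cmat i j :: 'a cmat)) = 0"
    using sum0 by simp
  then have "(\<Sum>(i, j)\<in>UNIV. f (unit_cmat i j) *\<^sub>C (unit_cmat i j :: 'a cmat)) $ i $ j = 0"
    by simp
  then show "f x = 0"
    unfolding sum_unit_cmat_nth x .
qed simp

lemma span_unit_cmat: "cmat.span (range (\<lambda>(i, j). unit_cmat i j)) = UNIV"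
proof -
  have "A = (\<Sum>(i, j)\<in>UNIV. A $ i $ j *\<^sub>C unit_cmat i j)" for A :: "'a cmat"
    by (simp only: vec_eq_iff sum_unit_cmat_nth) simp
  moreover have "(\<Sum>(i, j)\<in>UNIV. A $ i $ j *\<^sub>C unit_cmat i j)
      \<in> cmat.span (range (\<lambda>(i, j). unit_cmat i j))" for A :: "'a cmat"
    by (rule cmat.span_sum) (auto intro!: cmat.span_scale intro: cmat.span_base)
  ultimately show ?thesis by (metis UNIV_eq_I)
qed

interpretation cmat: finite_dimensional_vector_space
    "cmat_scale :: complex \<Rightarrow> 'm::finite cmat \<Rightarrow> 'm cmat" "range (\<lambda>(i, j). unit_cmat i j)"
  by unfold_locales (simp_all add: independent_unit_cmat span_unit_cmat)

text \<open>This count is used in two ways: it fixes the size of any error basis, and it lets the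
  tensors of basis elements span once they are independent and of the right number.\<close>

lemma dim_cmat: "cmat.dim (UNIV :: 'm::finite cmat set) = CARD('m) ^ 2"
  by (simp add: card_image[OF inj_unit_cmat] power2_eq_square)

text \<open>Commuting with the matrix unit at \<open>(i, j)\<close> and reading off entry
  \<open>(a, j)\<close> gives \<open>M $ a $ i\<close> on one side and, on the other,
  \<open>M $ j $ j\<close> if \<open>a = i\<close> and 0 otherwise. With \<open>j\<close> fixed and
  \<open>i\<close> varying this determines all of \<open>M\<close>.\<close>

lemma scalar_if_commutes_with_all:
  fixes M :: "'m::finite cmat"
  assumes "\<And>A. M ** A = A ** M"
  obtains c where "M = c *\<^sub>C mat 1"
proof
  fix j :: 'm
  have "M $ a $ i = (if a = i then M $ j $ j else 0)" for a i
  proof -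
    have "(M ** unit_cmat i j) $ a $ j = (unit_cmat i j ** M) $ a $ j"
      by (simp add: assms)
    then show ?thesis
      by (auto simp: matrix_matrix_mult_def unit_cmat_def if_distrib [where f = "\<lambda>x. x * _"]
          if_distrib [where f = "\<lambda>x. _ * x"] cong: if_cong)
  qed
  moreover have "(M $ j $ j *\<^sub>C mat 1) $ a $ i = (if a = i then M $ j $ j else 0)" for a i :: 'm
    by (simp add: mat_def)
  ultimately show "M = M $ j $ j *\<^sub>C mat 1"
    unfolding vec_eq_iff by metis
qed

lemma omega_eqI:
  assumes "A ** B = w *\<^sub>C (B ** A)" "B ** A \<noteq> 0"
  shows "omega A B = w"
  unfolding omega_def using assms by (auto simp: cmat.scale_cancel_right)

subsection \<open>The commutation character of an error basis\<close>

locale error_basis_matrices =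
  fixes \<E> :: "'m::finite cmat set"
  assumes error_basis: "error_basis \<E>"
begin

lemma unitary: "A \<in> \<E> \<Longrightarrow> unitary_mat A"
  and one_in [simp]: "mat 1 \<in> \<E>"
  and independent: "cmat.independent \<E>"
  and span: "cmat.span \<E> = UNIV"
  using error_basis by (auto simp: error_basis_def)

lemma finite_basis [simp]: "finite \<E>"
  by (rule cmat.finiteI_independent[OF independent])

lemma card_basis: "card \<E> = CARD('m) ^ 2"
  using cmat.basis_card_eq_dim[of \<E> UNIV] by (simp add: independent span dim_cmat del: cmat.dim_UNIV)

lemma mult_neq_0: "A \<in> \<E> \<Longrightarrow> B \<in> \<E> \<Longrightarrow> A ** B \<noteq> 0"
  by (intro unitary_mat_neq_0 unitary_mat_mult unitary)

lemma commutation: "A \<in> \<E> \<Longrightarrow> B \<in> \<E> \<Longrightarrow> A ** B = omega A B *\<^sub>C (B ** A)"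
  using error_basis omega_eqI[of A B] mult_neq_0[of B A] unfolding error_basis_def by metis

lemma commutation_mult:
  assumes "D \<in> \<E>" "A \<in> \<E>" "B \<in> \<E>"
  shows "D ** (A ** B) = (omega D A * omega D B) *\<^sub>C ((A ** B) ** D)"
proof -
  have "D ** (A ** B) = (omega D A *\<^sub>C (A ** D)) ** B"
    unfolding matrix_mul_assoc commutation[OF assms(1,2), symmetric] ..
  also have "\<dots> = omega D A *\<^sub>C (A ** (omega D B *\<^sub>C (B ** D)))"
    unfolding commutation[OF assms(1,3), symmetric] by (simp add: matrix_mul_assoc)
  also have "\<dots> = (omega D A * omega D B) *\<^sub>C ((A ** B) ** D)"
    by (simp add: matrix_mul_assoc)
  finally show ?thesis .
qed

text \<open>Linear independence forbids one basis element to be a multiple of another. Hence every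
  class of matrices up to nonzero scalars has at most one representative in the basis.\<close>

lemma proportional_imp_eq:
  assumes "A \<in> \<E>" "B \<in> \<E>" "A = c *\<^sub>C B"
  shows "A = B"
proof (rule ccontr)
  assume "A \<noteq> B"
  then have "A \<in> cmat.span (\<E> - {A})"
    using assms by (metis cmat.span_base cmat.span_scale insert_Diff insert_iff)
  then show False
    using independent assms(1) by (auto simp: cmat.dependent_def)
qed

lemma scalar_if_commutes:
  assumes "\<And>A. A \<in> \<E> \<Longrightarrow> M ** A = A ** M"
  obtains c where "M = c *\<^sub>C mat 1"
proof (rule scalar_if_commutes_with_all)
  fix A
  have "A \<in> cmat.span \<E>" by (simp add: span)
  then show "M ** A = A ** M"
    by (induction rule: cmat.span_induct_alt)
      (simp_all add: assms matrix_add_ldistrib cmat_mult_add_left)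
qed

text \<open>Nondegeneracy of \<open>omega\<close>: such a \<open>B\<close> commutes with a spanning
  set, so it is scalar, and \<open>mat 1\<close> is the only scalar matrix in the basis.\<close>

lemma eq_one_if_omega_eq_one:
  assumes "B \<in> \<E>" "\<And>A. A \<in> \<E> \<Longrightarrow> omega A B = 1"
  shows "B = mat 1"
proof -
  obtain c where "B = c *\<^sub>C mat 1"
    using assms commutation[OF _ assms(1)] by (metis cmat.scale_one scalar_if_commutes)
  then show ?thesis
    using assms(1) one_in proportional_imp_eq by blast
qed

text \<open>
  Expand \<open>A ** B\<close> in the basis: conjugation by any \<open>D\<close> acts on \<open>A ** B\<close> by one scalar and
  on each basis element by a scalar, so every basis element that occurs has the same
  commutation character as \<open>A ** B\<close> and hence differs from it by a matrix that commutes
  with everything.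
\<close>

lemma mult_proportional:
  assumes A: "A \<in> \<E>" and B: "B \<in> \<E>"
  obtains c F where "F \<in> \<E>" "cmod c = 1" "A ** B = c *\<^sub>C F"
proof -
  have "A ** B \<in> cmat.span \<E>" by (simp add: span)
  then obtain x where x: "A ** B = (\<Sum>F\<in>\<E>. x F *\<^sub>C F)"
    by (auto simp: cmat.span_finite)
  then obtain F where F: "F \<in> \<E>" "x F \<noteq> 0"
    using mult_neq_0[OF A B] by (metis (no_types, lifting) cmat.scale_zero_left sum.neutral)
  have char: "D ** (A ** B) = omega D F *\<^sub>C ((A ** B) ** D)" if D: "D \<in> \<E>" for D
  proof -
    let ?w = "omega D A * omega D B"
    have 1: "D ** (A ** B) = ?w *\<^sub>C ((A ** B) ** D)"
      by (rule commutation_mult[OF D A B])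
    have "D ** (A ** B) = (\<Sum>F\<in>\<E>. (x F * omega D F) *\<^sub>C F) ** D"
      unfolding x cmat_mult_sum_left cmat_mult_sum_right
      by (intro sum.cong) (simp_all add: commutation[OF D])
    moreover have "?w *\<^sub>C ((A ** B) ** D) = (\<Sum>F\<in>\<E>. (?w * x F) *\<^sub>C F) ** D"
      unfolding x cmat_mult_sum_left by (simp add: cmat.scale_sum_right)
    \<comment> \<open>The common right factor \<open>D\<close> is removed by its inverse
      \<open>adjoint_mat D\<close>; what remains are two expansions in the basis, whose coefficients
      can be compared.\<close>
    ultimately have "(\<Sum>F\<in>\<E>. (x F * omega D F) *\<^sub>C F) ** D ** adjoint_mat D =
        (\<Sum>F\<in>\<E>. (?w * x F) *\<^sub>C F) ** D ** adjoint_mat D"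
      using 1 by simp
    then have "(\<Sum>F\<in>\<E>. (x F * omega D F) *\<^sub>C F) = (\<Sum>F\<in>\<E>. (?w * x F) *\<^sub>C F)"
      using unitary[OF D] by (simp add: matrix_mul_assoc[symmetric] unitary_mat_def)
    then have "(\<Sum>F\<in>\<E>. (x F * omega D F - ?w * x F) *\<^sub>C F) = 0"
      by (simp add: cmat.scale_left_diff_distrib sum_subtractf)
    then have "x F * omega D F - ?w * x F = 0"
      by (rule cmat.independentD[OF independent finite_basis order_refl _ F(1)])
    then show ?thesis using 1 F(2) by auto
  qed
  let ?M = "adjoint_mat F ** (A ** B)"
  have "?M ** D = D ** ?M" if D: "D \<in> \<E>" for D
  proof -
    \<comment> \<open>The two orders of \<open>?M\<close> and \<open>D\<close> are compared after
      multiplying by \<open>F\<close> on the left. The scalar \<open>omega D F\<close> moves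
      \<open>D\<close> past \<open>F\<close> and also past \<open>A ** B\<close>, so it appears on
      both sides and cancels.\<close>
    have "F ** (?M ** D) = (A ** B) ** D"
      using unitary[OF F(1)] by (simp add: matrix_mul_assoc unitary_mat_def)
    moreover have "omega D F *\<^sub>C (F ** (D ** ?M)) = omega D F *\<^sub>C ((A ** B) ** D)"
    proof -
      have "omega D F *\<^sub>C (F ** (D ** ?M)) = (omega D F *\<^sub>C (F ** D)) ** ?M"
        by (simp add: matrix_mul_assoc)
      also have "\<dots> = D ** (F ** adjoint_mat F) ** (A ** B)"
        by (simp add: commutation[OF D F(1), symmetric] matrix_mul_assoc)
      also have "\<dots> = omega D F *\<^sub>C ((A ** B) ** D)"
        using unitary[OF F(1)] char[OF D] by (simp add: unitary_mat_def)
      finally show ?thesis .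
    qed
    moreover have "omega D F \<noteq> 0"
      using commutation[OF D F(1)] mult_neq_0[OF D F(1)] by auto
    ultimately have "F ** (?M ** D) = F ** (D ** ?M)"
      by (simp add: cmat.scale_cancel_left)
    then show ?thesis
      by (rule unitary_mat_cancel_left[OF unitary[OF F(1)]])
  qed
  then obtain c where "?M = c *\<^sub>C mat 1"
    by (rule scalar_if_commutes)
  then have "F ** ?M = c *\<^sub>C F" by simp
  then have "A ** B = c *\<^sub>C F"
    using unitary[OF F(1)] by (simp add: matrix_mul_assoc unitary_mat_def)
  moreover from this have "cmod c = 1"
    by (rule unitary_mat_scale_norm[rotated 2]) (auto intro: unitary_mat_mult unitary A B F)
  ultimately show ?thesis
    using that F(1) by blast
qed

text \<open>The group law modulo phases, carried by the basis itself instead of by cosets. For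
  factors in the basis the value exists by \<open>mult_proportional\<close> and is unique by
  \<open>proportional_imp_eq\<close>.\<close>

definition bprod :: "'m cmat \<Rightarrow> 'm cmat \<Rightarrow> 'm cmat"  (infixl \<open>\<odot>\<close> 70)
  where "A \<odot> B = (THE F. F \<in> \<E> \<and> (\<exists>c. cmod c = 1 \<and> A ** B = c *\<^sub>C F))"

lemma bprod_eqI:
  assumes "F \<in> \<E>" "cmod c = 1" "A ** B = c *\<^sub>C F"
  shows "A \<odot> B = F"
  unfolding bprod_def
proof (rule the_equality)
  fix F' assume "F' \<in> \<E> \<and> (\<exists>c. cmod c = 1 \<and> A ** B = c *\<^sub>C F')"
  then obtain c' where F': "F' \<in> \<E>" "cmod c' = 1" "A ** B = c' *\<^sub>C F'" by blast
  then have "F' = inverse c' *\<^sub>C (c *\<^sub>C F)"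
    using assms(3) by (metis cmat.scale_left_imp_eq cmat.scale_one cmat.scale_scale norm_zero
        right_inverse zero_neq_one)
  then show "F' = F"
    by (intro proportional_imp_eq[OF F'(1) assms(1), of "inverse c' * c"]) simp
qed (use assms in blast)

lemma bprod_props:
  assumes "A \<in> \<E>" "B \<in> \<E>"
  shows bprod_in: "A \<odot> B \<in> \<E>"
    and bprod_phase: "\<exists>c. cmod c = 1 \<and> A ** B = c *\<^sub>C (A \<odot> B)"
  using mult_proportional[OF assms] bprod_eqI by (metis, metis)

text \<open>The two ordinary products differ by the scalar \<open>omega A B\<close>, so they have
  the same representative.\<close>

lemma bprod_commute:
  assumes "A \<in> \<E>" "B \<in> \<E>"
  shows "A \<odot> B = B \<odot> A"
proof -
  obtain c where c: "B ** A = c *\<^sub>C (B \<odot> A)" "cmod c = 1"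
    using bprod_phase[OF assms(2,1)] by blast
  then have eq: "A ** B = (omega A B * c) *\<^sub>C (B \<odot> A)"
    using commutation[OF assms] by simp
  then have "cmod (omega A B * c) = 1"
    by (rule unitary_mat_scale_norm[rotated 2])
      (auto intro: unitary_mat_mult unitary assms bprod_in)
  then show ?thesis
    using bprod_eqI[OF bprod_in[OF assms(2,1)] _ eq] by simp
qed

lemma bprod_cancel_left:
  assumes "A \<in> \<E>" "B \<in> \<E>" "C \<in> \<E>" "A \<odot> B = A \<odot> C"
  shows "B = C"
proof -
  obtain c c' where c: "A ** B = c *\<^sub>C (A \<odot> C)" "A ** C = c' *\<^sub>C (A \<odot> C)" "cmod c' = 1"
    using bprod_phase[OF assms(1,2)] bprod_phase[OF assms(1,3)] unfolding assms(4) by blast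
  then have "c' \<noteq> 0" by auto
  then have "A ** B = A ** ((c * inverse c') *\<^sub>C C)"
    using c(1,2) by simp
  then have "B = (c * inverse c') *\<^sub>C C"
    by (rule unitary_mat_cancel_left[OF unitary[OF assms(1)]])
  then show ?thesis
    by (rule proportional_imp_eq[OF assms(2,3)])
qed

section \<open>The bicharacter \<open>omega\<close> and its character sums\<close>

lemma omega_swap:
  assumes "A \<in> \<E>" "B \<in> \<E>"
  shows "omega A B * omega B A = 1"
proof -
  have "A ** B = omega A B *\<^sub>C (omega B A *\<^sub>C (A ** B))"
    by (subst commutation[OF assms(2,1), symmetric]) (rule commutation[OF assms])
  then have "(omega A B * omega B A) *\<^sub>C (A ** B) = 1 *\<^sub>C (A ** B)"
    by simp
  then show ?thesis
    using mult_neq_0[OF assms] by (metis cmat.scale_cancel_right)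
qed

text \<open>Moving \<open>D\<close> past \<open>A\<close> and then past \<open>B\<close> collects
  both scalars; the phase between \<open>A ** B\<close> and its representative occurs on both sides
  and drops out.\<close>

lemma omega_bprod_right:
  assumes D: "D \<in> \<E>" and A: "A \<in> \<E>" and B: "B \<in> \<E>"
  shows "omega D (A \<odot> B) = omega D A * omega D B"
proof (rule omega_eqI)
  obtain c where c: "A ** B = c *\<^sub>C (A \<odot> B)" "cmod c = 1"
    using bprod_phase[OF A B] by blast
  have "D ** (A ** B) = (omega D A * omega D B) *\<^sub>C ((A ** B) ** D)"
    by (rule commutation_mult[OF D A B])
  then have "c *\<^sub>C (D ** (A \<odot> B)) = c *\<^sub>C ((omega D A * omega D B) *\<^sub>C ((A \<odot> B) ** D))"
    unfolding c(1) by (simp add: mult.commute)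
  then show "D ** (A \<odot> B) = (omega D A * omega D B) *\<^sub>C ((A \<odot> B) ** D)"
    by (rule cmat.scale_left_imp_eq[rotated]) (use c(2) in auto)
  show "A \<odot> B ** D \<noteq> 0"
    by (intro mult_neq_0 bprod_in A B D)
qed

text \<open>Exchanging the arguments inverts \<open>omega\<close>, so this follows from
  multiplicativity in the second argument.\<close>

lemma omega_bprod_left:
  assumes "A \<in> \<E>" "B \<in> \<E>" "D \<in> \<E>"
  shows "omega (A \<odot> B) D = omega A D * omega B D"
proof -
  have "omega (A \<odot> B) D * (omega D A * omega D B) = 1"
    using omega_swap[of "A \<odot> B" D] assms by (simp add: omega_bprod_right bprod_in)
  moreover have "(omega A D * omega B D) * (omega D A * omega D B) = 1"
    using omega_swap[OF assms(1,3)] omega_swap[OF assms(2,3)]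
    by (metis mult.assoc mult.left_commute mult_1_right)
  ultimately show ?thesis
    by (metis mult_cancel_right mult_zero_right zero_neq_one)
qed

text \<open>Translation by \<open>A\<close> is injective on the finite set \<open>X\<close> and maps
  it into itself, hence is onto. Inverses in \<open>X\<close> are later obtained from this
  surjectivity.\<close>

lemma bij_betw_bprod:
  assumes "X \<subseteq> \<E>" "\<And>A B. A \<in> X \<Longrightarrow> B \<in> X \<Longrightarrow> A \<odot> B \<in> X" "A \<in> X"
  shows "bij_betw ((\<odot>) A) X X"
proof -
  have inj: "inj_on ((\<odot>) A) X"
  proof (rule inj_onI)
    fix B C assume "B \<in> X" "C \<in> X" "A \<odot> B = A \<odot> C"
    then show "B = C"
      using bprod_cancel_left[of A B C] assms(1,3) by blast
  qed
  moreover have "(\<odot>) A ` X = X"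
    using assms(2,3) inj finite_subset[OF assms(1) finite_basis] by (intro endo_inj_surj) auto
  ultimately show ?thesis by (simp add: bij_betw_def)
qed

text \<open>Orthogonality of characters: translation by an \<open>A\<close> with \<open>h A\<close>
  different from 1 permutes the terms and multiplies the sum by \<open>h A\<close>, which forces the
  sum to be 0.\<close>

lemma sum_character:
  fixes h :: "'m cmat \<Rightarrow> complex"
  assumes "X \<subseteq> \<E>" "\<And>A B. A \<in> X \<Longrightarrow> B \<in> X \<Longrightarrow> A \<odot> B \<in> X"
    and "\<And>A B. A \<in> X \<Longrightarrow> B \<in> X \<Longrightarrow> h (A \<odot> B) = h A * h B"
  shows "(\<Sum>A\<in>X. h A) = (if \<forall>A\<in>X. h A = 1 then of_nat (card X) else 0)"
proof (cases "\<forall>A\<in>X. h A = 1")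
  case False
  then obtain A where A: "A \<in> X" "h A \<noteq> 1" by blast
  have "(\<Sum>B\<in>X. h B) = (\<Sum>B\<in>X. h (A \<odot> B))"
    by (rule sum.reindex_bij_betw[OF bij_betw_bprod[OF assms(1,2) A(1)], symmetric])
  also have "\<dots> = h A * (\<Sum>B\<in>X. h B)"
    using A(1) assms(3) by (simp add: sum_distrib_left)
  finally have "(1 - h A) * (\<Sum>B\<in>X. h B) = 0"
    by (simp add: algebra_simps)
  then have "(\<Sum>B\<in>X. h B) = 0" using A(2) by simp
  then show ?thesis unfolding if_not_P[OF False] .
qed simp

lemma sum_omega_basis:
  assumes "B \<in> \<E>"
  shows "(\<Sum>A\<in>\<E>. omega A B) = (if B = mat 1 then of_nat (CARD('m) ^ 2) else 0)"
proof -
  have "omega A (mat 1) = 1" if "A \<in> \<E>" for A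
    using mult_neq_0[OF one_in that] by (intro omega_eqI) auto
  then have "(\<forall>A\<in>\<E>. omega A B = 1) \<longleftrightarrow> B = mat 1"
    using eq_one_if_omega_eq_one[OF assms] by blast
  then show ?thesis
    using assms
    by (subst sum_character[of \<E>]) (simp_all add: bprod_in omega_bprod_left card_basis)
qed

text \<open>The orthogonal complement of \<open>X\<close> under \<open>omega\<close>. For the tensor
  basis and the stabilizer it is the normalizer.\<close>

definition commutant :: "'m cmat set \<Rightarrow> 'm cmat set"
  where "commutant X = {A \<in> \<E>. \<forall>B\<in>X. omega A B = 1}"

text \<open>The sum runs over the first argument of \<open>omega\<close>, whereas
  \<open>commutant\<close> constrains \<open>P\<close> as first argument; \<open>omega_swap\<close>
  shows that the two conditions agree.\<close>

lemma sum_omega_subgroup: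
  assumes "X \<subseteq> \<E>" "\<And>A B. A \<in> X \<Longrightarrow> B \<in> X \<Longrightarrow> A \<odot> B \<in> X" "P \<in> \<E>"
  shows "(\<Sum>A\<in>X. omega A P) = (if P \<in> commutant X then of_nat (card X) else 0)"
proof -
  have "omega A P = 1 \<longleftrightarrow> omega P A = 1" if "A \<in> X" for A
    using omega_swap[of A P] that assms by auto
  then have "(\<forall>A\<in>X. omega A P = 1) \<longleftrightarrow> P \<in> commutant X"
    using assms by (auto simp: commutant_def)
  then show ?thesis
    using assms by (subst sum_character[of X]) (auto simp: omega_bprod_left subset_iff)
qed

text \<open>
  The indicator of the commutant is the average of \<open>\<lambda>A. omega A B\<close> over \<open>B \<in> X\<close>; after
  exchanging the sums only the \<open>B\<close> inverse to \<open>P\<close> contributes.  This yields the cardinality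
  of the commutant and the double commutant property in one step.
\<close>

lemma sum_omega_commutant:
  assumes X: "X \<subseteq> \<E>" "\<And>A B. A \<in> X \<Longrightarrow> B \<in> X \<Longrightarrow> A \<odot> B \<in> X" "mat 1 \<in> X" and P: "P \<in> \<E>"
  shows "(\<Sum>A\<in>commutant X. omega A P) =
    (if P \<in> X then of_nat (CARD('m) ^ 2) / of_nat (card X) else 0)"
proof -
  have fin: "finite X" using X(1) finite_basis finite_subset by blast
  then have card: "(of_nat (card X) :: complex) \<noteq> 0" using X(3) by auto
  have inverse: "\<exists>C\<in>X. A \<odot> C = mat 1" if "A \<in> X" for A
    using bij_betw_imp_surj_on[OF bij_betw_bprod[OF X(1,2) that]] X(3) by (metis imageE)
  \<comment> \<open>An inverse of an element of \<open>X\<close> lies in \<open>X\<close>: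
    \<open>B\<close> has some inverse \<open>C\<close> in \<open>X\<close>, and cancelling
    \<open>B\<close> identifies \<open>P\<close> with \<open>C\<close>.\<close>
  have mem: "P \<in> X" if B: "P \<odot> B = mat 1" "B \<in> X" for B
  proof -
    obtain C where C: "C \<in> X" "B \<odot> C = mat 1" using inverse[OF B(2)] by blast
    have "B \<in> \<E>" "C \<in> \<E>" using B(2) C(1) X(1) by auto
    moreover from this have "B \<odot> P = B \<odot> C"
      using B(1) C(2) bprod_commute[OF P] by simp
    ultimately show ?thesis
      using bprod_cancel_left[OF _ P] C(1) by metis
  qed
  \<comment> \<open>The factor \<open>card X\<close> turns the indicator of the commutant into the
    full sum of the character of \<open>A\<close> over \<open>X\<close>, so that the outer sum can
    range over the whole basis.\<close>
  have "of_nat (card X) * (\<Sum>A\<in>commutant X. omega A P) =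
      (\<Sum>A\<in>\<E>. omega A P * (if A \<in> commutant X then of_nat (card X) else 0))"
    unfolding sum_distrib_left
    by (rule sum.mono_neutral_cong_left) (auto simp: commutant_def)
  also have "\<dots> = (\<Sum>A\<in>\<E>. omega A P * (\<Sum>B\<in>X. omega A B))"
  proof (rule sum.cong[OF refl])
    fix A assume A: "A \<in> \<E>"
    have "(\<Sum>B\<in>X. omega A B) = (if \<forall>B\<in>X. omega A B = 1 then of_nat (card X) else 0)"
      using X(1,2) A by (intro sum_character) (auto simp: omega_bprod_right subset_iff)
    then show "omega A P * (if A \<in> commutant X then of_nat (card X) else 0) =
        omega A P * (\<Sum>B\<in>X. omega A B)"
      using A by (simp add: commutant_def)
  qed
  also have "\<dots> = (\<Sum>B\<in>X. \<Sum>A\<in>\<E>. omega A (P \<odot> B))"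
    unfolding sum_distrib_left using X(1) P
    by (subst sum.swap) (auto intro!: sum.cong simp: omega_bprod_right subset_iff)
  also have "\<dots> = (\<Sum>B\<in>X. if P \<odot> B = mat 1 then of_nat (CARD('m) ^ 2) else 0)"
    using X(1) P by (intro sum.cong sum_omega_basis bprod_in refl) auto
  also have "\<dots> = (if P \<in> X then of_nat (CARD('m) ^ 2) else 0)"
  proof (cases "P \<in> X")
    case True
    then obtain B where B: "B \<in> X" "P \<odot> B = mat 1" using inverse by blast
    then have "P \<odot> C = mat 1 \<longleftrightarrow> C = B" if "C \<in> X" for C
      using bprod_cancel_left[of P C B] that X(1) P by auto
    then have "(\<Sum>B\<in>X. if P \<odot> B = mat 1 then of_nat (CARD('m) ^ 2) else 0) =
        (\<Sum>C\<in>X. if C = B then of_nat (CARD('m) ^ 2) else 0)"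
      by (intro sum.cong) auto
    then show ?thesis using B fin True by simp
  next
    case False
    then show ?thesis using mem by (auto intro!: sum.neutral)
  qed
  finally show ?thesis
    using card by (simp add: field_simps split: if_splits)
qed

text \<open>Translates the condition on pairs in the enumerator identities into the group law. A
  multiple of \<open>A ** B\<close> lying in \<open>X\<close> is a basis element proportional to the
  representative, hence equal to it.\<close>

lemma mem_up_to_phase_mult_iff:
  assumes "A \<in> \<E>" "B \<in> \<E>" "X \<subseteq> \<E>"
  shows "mem_up_to_phase (A ** B) X \<longleftrightarrow> A \<odot> B \<in> X"
proof -
  obtain c where c: "cmod c = 1" "A ** B = c *\<^sub>C (A \<odot> B)"
    using bprod_phase assms by blast
  have c0: "c \<noteq> 0" using c(1) by auto
  show ?thesis
  proof
    assume "mem_up_to_phase (A ** B) X"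
    then obtain a where a: "a *\<^sub>C (A ** B) \<in> X" unfolding mem_up_to_phase_def by blast
    have "a *\<^sub>C (A ** B) = (a * c) *\<^sub>C (A \<odot> B)"
      unfolding c(2) by simp
    then have "a *\<^sub>C (A ** B) = A \<odot> B"
      using proportional_imp_eq a assms(3) bprod_in[OF assms(1,2)] by blast
    then show "A \<odot> B \<in> X" using a by (simp only:)
  next
    assume "A \<odot> B \<in> X"
    moreover have "inverse c *\<^sub>C (A ** B) = A \<odot> B"
      unfolding c(2) using c0 by simp
    moreover have "cmod (inverse c) = 1"
      using c(1) by (simp add: norm_inverse)
    ultimately show "mem_up_to_phase (A ** B) X"
      unfolding mem_up_to_phase_def by metis
  qed
qed

end

section \<open>From a group of phase multiples to its set of basis elements\<close>

context error_basis_matrices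
begin

lemma phase_group_basis_elements:
  assumes group: "group (mat_monoid G)" and fin: "finite G"
    and phase: "\<forall>g\<in>G. \<exists>c E. cmod c = 1 \<and> E \<in> \<E> \<and> g = c *\<^sub>C E"
    and scalar: "\<forall>c. c *\<^sub>C mat 1 \<in> G \<longrightarrow> c = 1"
  defines "S \<equiv> {E \<in> \<E>. mem_up_to_phase E G}"
  shows one_in_basis_elements: "mat 1 \<in> S"
    and bprod_in_basis_elements: "A \<in> S \<Longrightarrow> B \<in> S \<Longrightarrow> A \<odot> B \<in> S"
    and card_basis_elements: "card S = card G"
proof -
  have one: "mat 1 \<in> G"
    using group.is_monoid[OF group, THEN monoid.one_closed] by (simp add: mat_monoid_def)
  have mult: "g ** h \<in> G" if "g \<in> G" "h \<in> G" for g h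
    using group.is_monoid[OF group, THEN monoid.m_closed, of g h] that by (simp add: mat_monoid_def)
  have inverse: "\<exists>h\<in>G. h ** g = mat 1" if "g \<in> G" for g
    using group.l_inv_ex[OF group, of g] that by (simp add: mat_monoid_def)
  show "mat 1 \<in> S"
    unfolding S_def mem_up_to_phase_def using one by (auto intro!: exI[of _ 1])
  show "A \<odot> B \<in> S" if AB: "A \<in> S" "B \<in> S"
  proof -
    obtain a b where ab: "A \<in> \<E>" "B \<in> \<E>" "cmod a = 1" "a *\<^sub>C A \<in> G" "cmod b = 1" "b *\<^sub>C B \<in> G"
      using AB unfolding S_def mem_up_to_phase_def by blast
    obtain c where c: "cmod c = 1" "A ** B = c *\<^sub>C (A \<odot> B)"
      using bprod_phase[OF ab(1,2)] by blast
    have "(a *\<^sub>C A) ** (b *\<^sub>C B) = (a * b) *\<^sub>C (A ** B)"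
      by (simp add: mult.commute)
    also have "\<dots> = (a * b * c) *\<^sub>C (A \<odot> B)"
      unfolding c(2) by simp
    finally have "(a * b * c) *\<^sub>C (A \<odot> B) \<in> G"
      using mult[OF ab(4,6)] by (simp only:)
    moreover have "cmod (a * b * c) = 1"
      using ab c by (simp add: norm_mult)
    ultimately show ?thesis
      using bprod_in[OF ab(1,2)] unfolding S_def mem_up_to_phase_def by blast
  qed
  \<comment> \<open>If \<open>E\<close> occurred in \<open>G\<close> with phases \<open>a\<close>
    and \<open>b\<close>, multiplying one occurrence by the inverse of the other would put the
    scalar \<open>b / a\<close> into \<open>G\<close>, and the only scalar there is 1.\<close>
  have phase_unique: "a = b" if E: "a *\<^sub>C E \<in> G" "b *\<^sub>C E \<in> G" "cmod a = 1" for a b E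
  proof -
    obtain h where h: "h \<in> G" "h ** (a *\<^sub>C E) = mat 1"
      using inverse[OF E(1)] by blast
    have a: "a \<noteq> 0" using E(3) by auto
    have "h ** (b *\<^sub>C E) = (b / a) *\<^sub>C (h ** (a *\<^sub>C E))"
      using a by simp
    then have "(b / a) *\<^sub>C mat 1 \<in> G"
      using mult[OF h(1) E(2)] unfolding h(2) by (simp only:)
    then have "b / a = 1" using scalar by blast
    then show ?thesis using a by simp
  qed
  have "\<forall>E\<in>S. \<exists>c. cmod c = 1 \<and> c *\<^sub>C E \<in> G"
    by (auto simp: S_def mem_up_to_phase_def)
  \<comment> \<open>Attaching the chosen phase maps \<open>S\<close> to \<open>G\<close>.
    Proportional basis elements are equal, which gives injectivity; uniqueness of phases gives
    surjectivity.\<close>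
  then obtain c where c: "\<And>E. E \<in> S \<Longrightarrow> cmod (c E) = 1 \<and> c E *\<^sub>C E \<in> G"
    by metis
  have "inj_on (\<lambda>E. c E *\<^sub>C E) S"
  proof (rule inj_onI)
    fix A B assume AB: "A \<in> S" "B \<in> S" "c A *\<^sub>C A = c B *\<^sub>C B"
    have "c A \<noteq> 0" using c[OF AB(1)] by auto
    then have "A = inverse (c A) *\<^sub>C (c A *\<^sub>C A)" by simp
    then have "A = (inverse (c A) * c B) *\<^sub>C B" unfolding AB(3) by simp
    then show "A = B"
      using AB(1,2) proportional_imp_eq unfolding S_def by blast
  qed
  moreover have "(\<lambda>E. c E *\<^sub>C E) ` S = G"
  proof (intro equalityI subsetI)
    fix g assume g: "g \<in> G"
    then obtain a E where aE: "cmod a = 1" "E \<in> \<E>" "g = a *\<^sub>C E"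
      using phase by blast
    then have "E \<in> S"
      using g unfolding S_def mem_up_to_phase_def by blast
    moreover from this have "a = c E"
      using phase_unique[of a E "c E"] c g aE by blast
    ultimately show "g \<in> (\<lambda>E. c E *\<^sub>C E) ` S"
      using aE(3) by blast
  qed (use c in blast)
  ultimately show "card S = card G"
    using card_image by metis
qed

end

subsection \<open>Tensor products\<close>

text \<open>The distributive law for sums over index vectors. It is why matrix products and traces
  of tensors can be computed site by site.\<close>

lemma sum_prod_vec:
  fixes f :: "'n::finite \<Rightarrow> 'q::finite \<Rightarrow> 'r::comm_semiring_1"
  shows "(\<Sum>k\<in>(UNIV :: ('q ^ 'n) set). \<Prod>i\<in>UNIV. f i (k $ i)) = (\<Prod>i\<in>UNIV. \<Sum>x\<in>UNIV. f i x)"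
proof -
  have "bij (vec_lambda :: ('n \<Rightarrow> 'q) \<Rightarrow> 'q ^ 'n)"
    by (rule bij_betw_byWitness[where f' = vec_nth]) auto
  then have "(\<Sum>k\<in>(UNIV :: ('q ^ 'n) set). \<Prod>i\<in>UNIV. f i (k $ i)) =
      (\<Sum>g\<in>UNIV. \<Prod>i\<in>UNIV. f i (vec_lambda g $ i))"
    by (rule sum.reindex_bij_betw[symmetric])
  also have "\<dots> = (\<Prod>i\<in>UNIV. \<Sum>x\<in>UNIV. f i x)"
    by (subst prod_sum_PiE) (simp_all add: PiE_UNIV_domain)
  finally show ?thesis .
qed

lemma tensor_mult: "tensor F ** tensor F' = tensor (\<lambda>i. F i ** F' i)"
  unfolding vec_eq_iff
proof (intro allI)
  fix r c
  show "(tensor F ** tensor F') $ r $ c = tensor (\<lambda>i. F i ** F' i) $ r $ c"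
    using sum_prod_vec[of "\<lambda>i x. F i $ (r $ i) $ x * F' i $ x $ (c $ i)"]
    by (simp add: tensor_def matrix_matrix_mult_def flip: prod.distrib)
qed

lemma tensor_one: "tensor (\<lambda>_. mat 1) = mat 1"
  by (auto simp: tensor_def mat_def vec_eq_iff intro!: prod.neutral prod_zero)

lemma tensor_scale: "tensor (\<lambda>i. c i *\<^sub>C F i) = (\<Prod>i\<in>UNIV. c i) *\<^sub>C tensor F"
  by (simp add: tensor_def vec_eq_iff prod.distrib)

lemma adjoint_tensor: "adjoint_mat (tensor F) = tensor (\<lambda>i. adjoint_mat (F i))"
  by (simp add: tensor_def adjoint_mat_def vec_eq_iff)

lemma trace_tensor: "trace (tensor F) = (\<Prod>i\<in>UNIV. trace (F i))"
  using sum_prod_vec[of "\<lambda>i x. F i $ x $ x"] by (simp add: tensor_def trace_def)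

lemma unitary_tensor: "(\<And>i. unitary_mat (F i)) \<Longrightarrow> unitary_mat (tensor F)"
  by (simp add: unitary_mat_def adjoint_tensor tensor_mult tensor_one)

section \<open>Tensor powers of an error basis\<close>

context error_basis_matrices
begin

lemma tensor_in_tensor_basis: "(\<And>i. F i \<in> \<E>) \<Longrightarrow> tensor F \<in> tensor_basis \<E>"
  by (auto simp: tensor_basis_def)

text \<open>The trace is the product of the traces at the sites, and a site where the factors differ
  contributes 0.\<close>

lemma trace_tensor_orthogonal:
  assumes "\<And>i. F i \<in> \<E>" "\<And>i. F' i \<in> \<E>" "F \<noteq> F'"
  shows "trace (adjoint_mat (tensor F) ** tensor F') = 0"
proof -
  obtain i where "F i \<noteq> F' i" using assms(3) by blast
  then have "trace (adjoint_mat (F i) ** F' i) = 0"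
    using error_basis assms(1,2) unfolding error_basis_def by blast
  then show ?thesis
    by (auto simp: adjoint_tensor tensor_mult trace_tensor)
qed

lemma trace_unitary:
  "unitary_mat (U :: 'k::finite cmat) \<Longrightarrow> trace (adjoint_mat U ** U) \<noteq> 0"
  by (simp add: unitary_mat_def trace_I)

text \<open>Distinct tuples give trace-orthogonal tensors, but a unitary is not orthogonal to
  itself.\<close>

lemma inj_on_tensor: "inj_on (tensor :: ('n::finite \<Rightarrow> _) \<Rightarrow> _) (UNIV \<rightarrow> \<E>)"
proof (rule inj_onI)
  fix F F' :: "'n \<Rightarrow> 'm cmat"
  assume F: "F \<in> UNIV \<rightarrow> \<E>" "F' \<in> UNIV \<rightarrow> \<E>" "tensor F = tensor F'"
  have "trace (adjoint_mat (tensor F) ** tensor F) \<noteq> 0"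
    using F(1) by (intro trace_unitary unitary_tensor unitary) auto
  then show "F = F'"
    using trace_tensor_orthogonal[of F F'] F by fastforce
qed

lemma tensor_basis_eq: "tensor_basis \<E> = tensor ` (UNIV \<rightarrow> \<E>)"
  by (auto simp: tensor_basis_def image_def Pi_def)

lemma card_tensor_basis:
  "card (tensor_basis \<E> :: ('m ^ 'n::finite) cmat set) = CARD('m ^ 'n) ^ 2"
proof -
  have "card (UNIV \<rightarrow> \<E> :: ('n \<Rightarrow> 'm cmat) set) = card \<E> ^ CARD('n)"
    using card_PiE[of "UNIV :: 'n set" "\<lambda>_. \<E>"] by (simp add: PiE_UNIV_domain Pi_def)
  then show ?thesis
    by (simp add: tensor_basis_eq card_image[OF inj_on_tensor] card_basis flip: power_mult)
      (simp add: mult.commute)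
qed

lemma finite_tensor_basis: "finite (tensor_basis \<E> :: ('m ^ 'n::finite) cmat set)"
  using card_tensor_basis by (metis card.infinite power_eq_0_iff zero_less_card_finite less_irrefl)

text \<open>Pairing a vanishing combination with \<open>T\<close> under the trace form annihilates
  every term except the one at \<open>T\<close>.\<close>

lemma independent_tensor_basis:
  "cmat.independent (tensor_basis \<E> :: ('m ^ 'n::finite) cmat set)"
proof (rule cmat.independent_if_scalars_zero[OF finite_tensor_basis])
  fix f :: "('m ^ 'n) cmat \<Rightarrow> complex" and T :: "('m ^ 'n) cmat"
  assume sum0: "(\<Sum>T\<in>tensor_basis \<E>. f T *\<^sub>C T) = 0" and T: "T \<in> tensor_basis \<E>"
  then obtain F where F: "T = tensor F" "\<And>i. F i \<in> \<E>"
    by (auto simp: tensor_basis_def)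
  have "trace (adjoint_mat T ** T') = 0" if "T' \<in> tensor_basis \<E>" "T' \<noteq> T" for T'
    using that F trace_tensor_orthogonal[of F] by (auto simp: tensor_basis_def)
  then have "(\<Sum>T'\<in>tensor_basis \<E>. f T' * trace (adjoint_mat T ** T')) =
      (\<Sum>T'\<in>{T}. f T' * trace (adjoint_mat T ** T'))"
    using T by (intro sum.mono_neutral_right finite_tensor_basis) auto
  moreover have "(\<Sum>T'\<in>tensor_basis \<E>. f T' * trace (adjoint_mat T ** T')) =
      trace (adjoint_mat T ** (\<Sum>T\<in>tensor_basis \<E>. f T *\<^sub>C T))"
    by (simp add: cmat_mult_sum_right trace_sum)
  moreover have "trace (adjoint_mat T ** T) \<noteq> 0"
    unfolding F(1) by (intro trace_unitary unitary_tensor unitary F(2))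
  ultimately show "f T = 0"
    by (simp add: sum0) (simp add: trace_def)
qed

lemma tensor_commutation:
  assumes "\<And>i. F i \<in> \<E>" "\<And>i. F' i \<in> \<E>"
  shows "tensor F ** tensor F' = (\<Prod>i\<in>UNIV. omega (F i) (F' i)) *\<^sub>C (tensor F' ** tensor F)"
proof -
  have "(\<lambda>i. F i ** F' i) = (\<lambda>i. omega (F i) (F' i) *\<^sub>C (F' i ** F i))"
    using commutation[OF assms] by (rule ext)
  then show ?thesis
    by (simp add: tensor_mult tensor_scale)
qed

lemma omega_tensor:
  assumes "\<And>i. F i \<in> \<E>" "\<And>i. F' i \<in> \<E>"
  shows "omega (tensor F) (tensor F') = (\<Prod>i\<in>UNIV. omega (F i) (F' i))"
  using tensor_commutation[OF assms]
  by (rule omega_eqI) (intro unitary_mat_neq_0 unitary_mat_mult unitary_tensor unitary assms)+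

lemma error_basis_tensor_basis: "error_basis (tensor_basis \<E> :: ('m ^ 'n::finite) cmat set)"
proof -
  \<comment> \<open>Spanning needs no explicit expansion: an independent set with as many elements
    as the dimension spans.\<close>
  have "UNIV \<subseteq> cmat.span (tensor_basis \<E> :: ('m ^ 'n) cmat set)"
    by (intro cmat.card_ge_dim_independent independent_tensor_basis)
      (simp_all add: dim_cmat card_tensor_basis del: CARD_vec cmat.dim_UNIV)
  moreover have "(mat 1 :: ('m ^ 'n) cmat) \<in> tensor_basis \<E>"
    using tensor_in_tensor_basis[of "\<lambda>_. mat 1"] by (simp add: tensor_one)
  moreover have "\<exists>r>0. \<forall>E\<in>tensor_basis \<E>. \<forall>F\<in>tensor_basis \<E>.
      \<exists>w. E ** F = w *\<^sub>C (F ** E :: ('m ^ 'n) cmat) \<and> w ^ r = 1"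
  proof -
    \<comment> \<open>The exponent of the one-site basis also serves for the tensors, since a
      product of \<open>r\<close>-th roots of unity is again one.\<close>
    obtain r where r: "r > 0" "\<And>E F. E \<in> \<E> \<Longrightarrow> F \<in> \<E> \<Longrightarrow> \<exists>w. E ** F = w *\<^sub>C (F ** E) \<and> w ^ r = 1"
      using error_basis unfolding error_basis_def by blast
    have omega_root: "omega E F ^ r = 1" if "E \<in> \<E>" "F \<in> \<E>" for E F
      using r(2)[OF that] omega_eqI mult_neq_0[OF that(2,1)] by metis
    have "\<exists>w. T ** T' = w *\<^sub>C (T' ** T) \<and> w ^ r = 1"
      if T: "T \<in> tensor_basis \<E>" "T' \<in> tensor_basis \<E>" for T T' :: "('m ^ 'n) cmat"
    proof -
      obtain F F' where F: "T = tensor F" "\<And>i. F i \<in> \<E>" "T' = tensor F'" "\<And>i. F' i \<in> \<E>"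
        using T by (auto simp: tensor_basis_def)
      have "(\<Prod>i\<in>UNIV. omega (F i) (F' i)) ^ r = 1"
        by (simp add: omega_root F(2,4) prod_power_distrib)
      then show ?thesis
        unfolding F(1,3) by (intro exI conjI) (rule tensor_commutation[OF F(2,4)])
    qed
    then show ?thesis using r(1) by blast
  qed
  moreover have "trace (adjoint_mat T ** T') = 0"
    if "T \<in> tensor_basis \<E>" "T' \<in> tensor_basis \<E>" "T \<noteq> T'" for T T' :: "('m ^ 'n) cmat"
    using that trace_tensor_orthogonal unfolding tensor_basis_def by blast
  moreover have "unitary_mat T" if "T \<in> tensor_basis \<E>" for T :: "('m ^ 'n) cmat"
    using that unitary by (auto simp: tensor_basis_def intro: unitary_tensor)
  ultimately show ?thesis
    unfolding error_basis_def using independent_tensor_basis by blast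
qed

end

subsection \<open>Substitution and the MacWilliams identities\<close>

lemma Const_0 [simp]: "Const 0 = 0"
  and Const_1 [simp]: "Const 1 = 1"
  and Const_add: "Const (a + b) = Const a + Const b"
  and Const_mult: "Const (a * b) = Const a * Const b"
  by (simp_all add: Const_def single_add mult_single)

lemma Const_sum: "Const (\<Sum>x\<in>X. f x) = (\<Sum>x\<in>X. Const (f x))"
  by (induction X rule: infinite_finite_induct) (simp_all add: Const_add)

lemma Const_prod: "Const (\<Prod>x\<in>X. f x) = (\<Prod>x\<in>X. Const (f x))"
  by (induction X rule: infinite_finite_induct) (simp_all add: Const_mult)

lemma Const_power: "Const (a ^ k) = Const a ^ k"
  by (induction k) (simp_all add: Const_mult)

lemma tuple_power_0 [simp]: "tuple_power u 0 = 1"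
  by (simp add: tuple_power_def)

lemma tuple_power_add: "tuple_power u (a + b) = tuple_power u a * tuple_power u b"
  by (simp add: tuple_power_def power_add prod.distrib)

lemma tuple_power_sum: "tuple_power u (\<Sum>i\<in>I. a i) = (\<Prod>i\<in>I. tuple_power u (a i))"
  by (induction I rule: infinite_finite_induct) (simp_all add: tuple_power_add)

text \<open>Allows several polynomials to be summed over one common set of monomials, in particular
  when cancellation makes the support of a sum smaller than the union of the supports.\<close>

lemma subst_poly_superset:
  assumes "finite K" "Poly_Mapping.keys p \<subseteq> K"
  shows "subst_poly p u =
    (\<Sum>m\<in>K. Const (Poly_Mapping.lookup p m) * tuple_power u (\<chi> j. Poly_Mapping.lookup m j))"
  unfolding subst_poly_def using assms
  by (intro sum.mono_neutral_left) (auto simp: in_keys_iff)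

lemma subst_poly_0 [simp]: "subst_poly 0 u = 0"
  by (simp add: subst_poly_def)

lemma subst_poly_add: "subst_poly (p + q) u = subst_poly p u + subst_poly q u"
proof -
  let ?K = "Poly_Mapping.keys p \<union> Poly_Mapping.keys q"
  have "Poly_Mapping.keys (p + q) \<subseteq> ?K" by (rule Poly_Mapping.keys_add)
  then show ?thesis
    by (simp add: subst_poly_superset[of ?K] lookup_add Const_add distrib_right sum.distrib)
qed

lemma subst_poly_sum: "subst_poly (\<Sum>x\<in>X. f x) u = (\<Sum>x\<in>X. subst_poly (f x) u)"
  by (induction X rule: infinite_finite_induct) (simp_all add: subst_poly_add)

lemma subst_poly_single:
  "subst_poly (Poly_Mapping.single m c) u = Const c * tuple_power u (\<chi> j. Poly_Mapping.lookup m j)"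
  by (simp add: subst_poly_superset[of "{m}"])

lemma sum_single_lookup:
  "(\<Sum>m\<in>Poly_Mapping.keys p. Poly_Mapping.single m (Poly_Mapping.lookup p m)) = p"
  by (rule poly_mapping_eqI) (auto simp: lookup_sum lookup_single when_def in_keys_iff)

text \<open>Both factors are split into monomials; additivity reduces the claim to two monomials,
  where exponents add and coefficients multiply.\<close>

lemma subst_poly_mult:
  fixes p q :: "'l::finite mpoly"
  shows "subst_poly (p * q) u = subst_poly p u * subst_poly q u"
proof -
  let ?s = "\<lambda>p m. Poly_Mapping.single m (Poly_Mapping.lookup p m) :: 'l mpoly"
  have single: "subst_poly (?s p m * ?s q m') u = subst_poly (?s p m) u * subst_poly (?s q m') u"
    for m m'
  proof -
    have "(\<chi> j. Poly_Mapping.lookup (m + m') j) =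
        (\<chi> j. Poly_Mapping.lookup m j) + (\<chi> j. Poly_Mapping.lookup m' j)"
      by (simp add: vec_eq_iff lookup_add)
    then show ?thesis
      unfolding mult_single subst_poly_single
      by (simp only: Const_mult tuple_power_add mult_ac)
  qed
  have "p * q = (\<Sum>m\<in>Poly_Mapping.keys p. ?s p m) * (\<Sum>m\<in>Poly_Mapping.keys q. ?s q m)"
    by (simp only: sum_single_lookup)
  also have "subst_poly \<dots> u =
      (\<Sum>m\<in>Poly_Mapping.keys p. subst_poly (?s p m) u) *
      (\<Sum>m\<in>Poly_Mapping.keys q. subst_poly (?s q m) u)"
    by (simp only: sum_product subst_poly_sum single)
  also have "\<dots> = subst_poly p u * subst_poly q u"
    by (simp only: subst_poly_sum[symmetric] sum_single_lookup)
  finally show ?thesis .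
qed

lemma subst_poly_Const [simp]: "subst_poly (Const c) u = Const c"
  unfolding Const_def by (subst subst_poly_single) (simp add: tuple_power_def Const_def)

lemma subst_poly_1 [simp]: "subst_poly 1 u = 1"
  using subst_poly_Const[of 1 u] by simp

lemma subst_poly_prod: "subst_poly (\<Prod>x\<in>X. f x) u = (\<Prod>x\<in>X. subst_poly (f x) u)"
  by (induction X rule: infinite_finite_induct) (simp_all add: subst_poly_mult)

lemma subst_poly_power: "subst_poly (p ^ k) u = subst_poly p u ^ k"
  by (induction k) (simp_all add: subst_poly_mult)

lemma subst_poly_Var [simp]: "subst_poly (Var j) u = u $ j"
proof -
  have "tuple_power u (\<chi> i. Poly_Mapping.lookup (Poly_Mapping.single j 1) i) =
      (\<Prod>i\<in>UNIV. if i = j then u $ j else 1)"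
    unfolding tuple_power_def by (intro prod.cong) (auto simp: lookup_single)
  then show ?thesis
    by (simp add: Var_def subst_poly_single)
qed

lemma subst_poly_tuple_power: "subst_poly (tuple_power v a) u = tuple_power (apply_map v u) a"
  by (simp add: tuple_power_def subst_poly_prod subst_poly_power apply_map_def)

text \<open>The transform is defined by an identity in its own indeterminates. Substitution is a
  ring homomorphism, so the identity passes to any tuple \<open>u\<close>, such as one in the joint
  indeterminates of two weights.\<close>

lemma macwilliams_transform_subst:
  assumes "macwilliams_transform \<E> w \<Phi>" "D \<in> \<E>"
  shows "tuple_power (apply_map \<Phi> u) (w D) =
    Const (1 / of_nat CARD('q)) *
      (\<Sum>E\<in>(\<E> :: 'q::finite cmat set). Const (omega D E) * tuple_power u (w E))"
proof -
  have "subst_poly (tuple_power \<Phi> (w D)) u =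
      subst_poly (Const (1 / of_nat CARD('q)) *
        (\<Sum>E\<in>\<E>. Const (omega D E) * tuple_power (\<chi> j. Var j) (w E))) u"
    using assms unfolding macwilliams_transform_def Let_def by (simp only: apply_map_Var)
  moreover have "apply_map (\<chi> j. Var j) u = u"
    by (simp add: apply_map_def vec_eq_iff)
  ultimately show ?thesis
    by (simp add: subst_poly_tuple_power subst_poly_mult subst_poly_sum)
qed

section \<open>The transform on the tensor power and the sum over a subgroup\<close>

context error_basis_matrices
begin

lemma macwilliams_transform_tensor_basis:
  fixes w :: "'n::finite \<Rightarrow> 'm cmat \<Rightarrow> nat ^ 'l::finite"
  assumes wt: "weight_given_by \<E> w wt" and mw: "macwilliams_transform_tensor \<E> w \<Phi>"
    and D: "D \<in> tensor_basis \<E>"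
  shows "tuple_power (apply_map \<Phi> u) (wt D) =
    Const (1 / of_nat (CARD('m) ^ CARD('n))) *
      (\<Sum>E\<in>tensor_basis \<E>. Const (omega D E) * tuple_power u (wt E))"
proof -
  obtain F where F: "D = tensor F" "\<And>i. F i \<in> \<E>"
    using D by (auto simp: tensor_basis_def)
  have "tuple_power (apply_map \<Phi> u) (wt D) = (\<Prod>i\<in>UNIV. tuple_power (apply_map \<Phi> u) (w i (F i)))"
    using wt F by (simp add: weight_given_by_def tuple_power_sum)
  also have "\<dots> = (\<Prod>i\<in>UNIV. Const (1 / of_nat CARD('m)) *
      (\<Sum>E\<in>\<E>. Const (omega (F i) E) * tuple_power u (w i E)))"
    using mw F(2) macwilliams_transform_subst
    unfolding macwilliams_transform_tensor_def by (intro prod.cong refl) blast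
  also have "\<dots> = Const (1 / of_nat (CARD('m) ^ CARD('n))) *
      (\<Prod>i\<in>UNIV. \<Sum>E\<in>\<E>. Const (omega (F i) E) * tuple_power u (w i E))"
    by (simp add: prod.distrib flip: Const_power power_one_over)
  \<comment> \<open>Expanding the product chooses one basis element at each site; by injectivity of
    \<open>tensor\<close> these choices run once through the tensor basis.\<close>
  also have "(\<Prod>i\<in>UNIV. \<Sum>E\<in>\<E>. Const (omega (F i) E) * tuple_power u (w i E)) =
      (\<Sum>F'\<in>UNIV \<rightarrow> \<E>. \<Prod>i\<in>UNIV. Const (omega (F i) (F' i)) * tuple_power u (w i (F' i)))"
    by (subst prod_sum_PiE) (simp_all add: PiE_UNIV_domain Pi_def)
  also have "\<dots> = (\<Sum>F'\<in>UNIV \<rightarrow> \<E>. Const (omega D (tensor F')) * tuple_power u (wt (tensor F')))"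
    using wt F
    by (intro sum.cong refl)
      (simp add: prod.distrib omega_tensor Const_prod weight_given_by_def tuple_power_sum Pi_def)
  also have "\<dots> = (\<Sum>E\<in>tensor_basis \<E>. Const (omega D E) * tuple_power u (wt E))"
    by (simp add: tensor_basis_eq sum.reindex[OF inj_on_tensor])
  finally show ?thesis .
qed

text \<open>The common core of both identities, applied with \<open>X\<close> and \<open>Y\<close>
  the normalizer and the stabilizer in either order. All that is asked of this pair beyond inclusion
  in the basis is the character sum, with \<open>v\<close> its nonzero value.\<close>

lemma sum_transform_product:
  fixes f1 f2 :: "'m cmat \<Rightarrow> 'x mpoly" and c v :: complex
  assumes X: "X \<subseteq> \<E>" and Y: "Y \<subseteq> \<E>"
    and g1: "\<And>D. D \<in> \<E> \<Longrightarrow> g1 D = Const c * (\<Sum>E\<in>\<E>. Const (omega D E) * f1 E)"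
    and g2: "\<And>D. D \<in> \<E> \<Longrightarrow> g2 D = Const c * (\<Sum>E\<in>\<E>. Const (omega D E) * f2 E)"
    and sum: "\<And>P. P \<in> \<E> \<Longrightarrow> (\<Sum>D\<in>X. omega D P) = (if P \<in> Y then v else 0)"
  shows "(\<Sum>D\<in>X. g1 D * g2 D) = Const (c\<^sup>2 * v) *
    (\<Sum>(E1, E2) \<in> {(E1, E2). E1 \<in> \<E> \<and> E2 \<in> \<E> \<and> mem_up_to_phase (E1 ** E2) Y}. f1 E1 * f2 E2)"
proof -
  have "g1 D * g2 D = Const (c\<^sup>2) *
      (\<Sum>(E1, E2)\<in>\<E> \<times> \<E>. Const (omega D (E1 \<odot> E2)) * (f1 E1 * f2 E2))" if "D \<in> X" for D
  proof -
    have D: "D \<in> \<E>" using that X by blast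
    have "g1 D * g2 D = Const (c\<^sup>2) *
        ((\<Sum>E\<in>\<E>. Const (omega D E) * f1 E) * (\<Sum>E\<in>\<E>. Const (omega D E) * f2 E))"
      by (simp add: g1[OF D] g2[OF D] power2_eq_square Const_mult mult_ac)
    also have "(\<Sum>E\<in>\<E>. Const (omega D E) * f1 E) * (\<Sum>E\<in>\<E>. Const (omega D E) * f2 E) =
        (\<Sum>(E1, E2)\<in>\<E> \<times> \<E>. Const (omega D (E1 \<odot> E2)) * (f1 E1 * f2 E2))"
      unfolding sum_product sum.cartesian_product
      by (intro sum.cong refl) (auto simp: omega_bprod_right[OF D] Const_mult mult_ac)
    finally show ?thesis .
  qed
  then have "(\<Sum>D\<in>X. g1 D * g2 D) = Const (c\<^sup>2) *
      (\<Sum>D\<in>X. \<Sum>(E1, E2)\<in>\<E> \<times> \<E>. Const (omega D (E1 \<odot> E2)) * (f1 E1 * f2 E2))"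
    by (simp add: sum_distrib_left)
  also have "(\<Sum>D\<in>X. \<Sum>(E1, E2)\<in>\<E> \<times> \<E>. Const (omega D (E1 \<odot> E2)) * (f1 E1 * f2 E2)) =
      (\<Sum>(E1, E2)\<in>\<E> \<times> \<E>. Const (\<Sum>D\<in>X. omega D (E1 \<odot> E2)) * (f1 E1 * f2 E2))"
    \<comment> \<open>With the sum over \<open>D\<close> innermost, the weights no longer depend on
      \<open>D\<close> and only a character sum at the product of the pair is left.\<close>
    by (subst sum.swap) (simp add: Const_sum sum_distrib_right case_prod_beta)
  also have "\<dots> = (\<Sum>(E1, E2)\<in>\<E> \<times> \<E>. if mem_up_to_phase (E1 ** E2) Y
      then Const v * (f1 E1 * f2 E2) else 0)"
    by (intro sum.cong refl)
      (auto simp: sum bprod_in mem_up_to_phase_mult_iff[OF _ _ Y])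
  also have "\<dots> = (\<Sum>(E1, E2)\<in>{(E1, E2). E1 \<in> \<E> \<and> E2 \<in> \<E> \<and> mem_up_to_phase (E1 ** E2) Y}.
      Const v * (f1 E1 * f2 E2))"
    by (rule sum.mono_neutral_cong_right) (auto split: if_splits)
  also have "\<dots> = Const v *
      (\<Sum>(E1, E2)\<in>{(E1, E2). E1 \<in> \<E> \<and> E2 \<in> \<E> \<and> mem_up_to_phase (E1 ** E2) Y}. f1 E1 * f2 E2)"
    by (simp add: sum_distrib_left case_prod_beta)
  finally show ?thesis
    by (simp add: Const_mult mult.assoc)
qed

end

theorem theorem43:
  fixes \<E> :: "'q::finite cmat set"
    and G :: "('q ^ 'n::finite) cmat set"
    and C :: "(complex ^ ('q ^ 'n)) set"
    and k d :: nat
    and w1 :: "'n \<Rightarrow> 'q cmat \<Rightarrow> nat ^ 'l1::finite"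
    and w2 :: "'n \<Rightarrow> 'q cmat \<Rightarrow> nat ^ 'l2::finite"
    and wt1 :: "('q ^ 'n) cmat \<Rightarrow> nat ^ 'l1"
    and wt2 :: "('q ^ 'n) cmat \<Rightarrow> nat ^ 'l2"
    and \<Phi>1 :: "'l1 mpoly ^ 'l1"
    and \<Phi>2 :: "'l2 mpoly ^ 'l2"
    and u1 :: "('l1 + 'l2) mpoly ^ 'l1"
    and u2 :: "('l1 + 'l2) mpoly ^ 'l2"
  assumes "error_basis \<E>"
    and "stabilizer_code \<E> k d G C"
    and "weight_given_by \<E> w1 wt1" and "macwilliams_transform_tensor \<E> w1 \<Phi>1"
    and "weight_given_by \<E> w2 wt2" and "macwilliams_transform_tensor \<E> w2 \<Phi>2"
    and "u1 = (\<chi> j. Var (Inl j))" and "u2 = (\<chi> j. Var (Inr j))"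
  shows "((\<Sum>D\<in>normalizer \<E> G.
            tuple_power (apply_map \<Phi>1 u1) (wt1 D) * tuple_power (apply_map \<Phi>2 u2) (wt2 D)) =
         Const (1 / of_nat (CARD('q) ^ (CARD('n) - k))) *
         (\<Sum>(E1, E2) \<in> {(E1, E2). E1 \<in> tensor_basis \<E> \<and> E2 \<in> tensor_basis \<E> \<and>
                                  mem_up_to_phase (E1 ** E2) (stabilizer \<E> G)}.
            tuple_power u1 (wt1 E1) * tuple_power u2 (wt2 E2))) \<and>
         ((\<Sum>D\<in>stabilizer \<E> G.
            tuple_power (apply_map \<Phi>1 u1) (wt1 D) * tuple_power (apply_map \<Phi>2 u2) (wt2 D)) =
         Const (1 / of_nat (CARD('q) ^ (CARD('n) + k))) *
         (\<Sum>(E1, E2) \<in> {(E1, E2). E1 \<in> tensor_basis \<E> \<and> E2 \<in> tensor_basis \<E> \<and>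
                                  mem_up_to_phase (E1 ** E2) (normalizer \<E> G)}.
            tuple_power u1 (wt1 E1) * tuple_power u2 (wt2 E2)))"
proof -
  interpret error_basis_matrices \<E> by unfold_locales (rule assms(1))
  \<comment> \<open>The group theory and character sums are used for the tensor basis; the one-site
    basis supplies the transforms.\<close>
  interpret T: error_basis_matrices "tensor_basis \<E> :: ('q ^ 'n) cmat set"
    by unfold_locales (rule error_basis_tensor_basis)
  have stab: "stabilizer_group \<E> k G"
    using assms(2) by (simp add: stabilizer_code_def)
  then have k: "k \<le> CARD('n)" and card_G: "card G = CARD('q) ^ (CARD('n) - k)"
    by (simp_all add: stabilizer_group_def)
  have S_eq: "stabilizer \<E> G = {E \<in> tensor_basis \<E>. mem_up_to_phase E G}"
    by (simp add: stabilizer_def)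
  have N_eq: "normalizer \<E> G = T.commutant (stabilizer \<E> G)"
    by (simp add: normalizer_def T.commutant_def)
  have "group (mat_monoid G)" "finite G"
    "\<forall>g\<in>G. \<exists>c E. cmod c = 1 \<and> E \<in> tensor_basis \<E> \<and> g = c *\<^sub>C E"
    "\<forall>c. c *\<^sub>C mat 1 \<in> G \<longrightarrow> c = 1"
    using stab unfolding stabilizer_group_def by (blast intro: comm_group.axioms(2))+
  note S = T.one_in_basis_elements[OF this, folded S_eq]
    T.bprod_in_basis_elements[OF this, folded S_eq] T.card_basis_elements[OF this, folded S_eq]
  have sub: "stabilizer \<E> G \<subseteq> tensor_basis \<E>" "normalizer \<E> G \<subseteq> tensor_basis \<E>"
    by (auto simp: stabilizer_def normalizer_def)
  note mw = macwilliams_transform_tensor_basis[OF assms(3,4)]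
    macwilliams_transform_tensor_basis[OF assms(5,6)]
  \<comment> \<open>The bound on \<open>k\<close> makes the truncated difference in the exponent a
    true one.\<close>
  have q: "CARD('q) ^ CARD('n) = CARD('q) ^ (CARD('n) - k) * CARD('q) ^ k"
    using k by (simp flip: power_add)
  let ?Q = "of_nat (CARD('q) ^ CARD('n)) :: complex" and ?K = "of_nat (CARD('q) ^ k) :: complex"
    and ?R = "of_nat (CARD('q) ^ (CARD('n) - k)) :: complex"
  have Q: "?Q = ?R * ?K" "?R \<noteq> 0" "?K \<noteq> 0"
    unfolding q by simp_all
  \<comment> \<open>Two transforms contribute q^(-2n), which cancels the size q^(2n) of the tensor
    basis and leaves the inverse order of the stabilizer.\<close>
  have scale_N: "(1 / ?Q)\<^sup>2 * (of_nat (CARD('q ^ 'n) ^ 2) / ?R) = 1 / ?R"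
    using Q(2,3) unfolding CARD_vec of_nat_power[of _ 2] Q(1)
    by (simp add: field_simps power2_eq_square)
  \<comment> \<open>Here q^(-2n) meets the order q^(n-k) of the stabilizer, which gives
    q^(-(n+k)).\<close>
  have scale_S: "(1 / ?Q)\<^sup>2 * ?R = 1 / of_nat (CARD('q) ^ (CARD('n) + k))"
    using Q(2,3) unfolding power_add of_nat_mult Q(1)
    by (simp add: field_simps power2_eq_square)
  have sum_N: "(\<Sum>D\<in>normalizer \<E> G. omega D P) =
      (if P \<in> stabilizer \<E> G then of_nat (CARD('q ^ 'n) ^ 2) / ?R else 0)"
    if "P \<in> tensor_basis \<E>" for P
    unfolding N_eq card_G[symmetric] S(3)[symmetric]
    by (rule T.sum_omega_commutant[OF sub(1) S(2,1) that])
  have sum_S: "(\<Sum>D\<in>stabilizer \<E> G. omega D P) = (if P \<in> normalizer \<E> G then ?R else 0)"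
    if "P \<in> tensor_basis \<E>" for P
    unfolding N_eq card_G[symmetric] S(3)[symmetric]
    by (rule T.sum_omega_subgroup[OF sub(1) S(2) that])
  show ?thesis
    using T.sum_transform_product[OF sub(2,1) mw sum_N]
      T.sum_transform_product[OF sub(1,2) mw sum_S]
    unfolding scale_N scale_S by blast
qed

end
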